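(* Let $\mathcal{G}$ be a connected (undirected, weighted) graph on $N$ nodes with weights $\mathsf{a}_{ij}=\mathsf{a}_{ji}$. For each $i\in\{1,\dots,N\}$ let $f^i:\mathbb{R}^d\to\mathbb{R}$ be convex and differentiable on $\mathbb{R}^d$, and suppose that $f=\sum_{i=1}^N f^i$ is strictly convex and attains its minimum on $\mathbb{R}^d$, at the (necessarily unique) point $\mathsf{x}^\star$. Then, for any $\alpha,\beta>0$, every initial condition $x^i(0),v^i(0)\in\mathbb{R}^d$, $i\in\{1,\dots,N\}$, with $\sum_{i=1}^N v^i(0)=0$, and each $i\in\{1,\dots,N\}$, the system $$\dot v^i=\alpha\beta\sum_{j=1}^N\mathsf{a}_{ij}(x^i-x^j),\qquad \dot x^i=-\alpha\nabla f^i(x^i)-\beta\sum_{j=1}^N\mathsf{a}_{ij}(x^i-x^j)-v^i,\qquad i\in\{1,\dots,N\},$$ makes $x^i(t)\to\mathsf{x}^\star$ as $t\to\infty$.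
   Context: A weighted graph on nodes $\{1,\dots,N\}$ has a nonnegative adjacency matrix $(\mathsf{a}_{ij})$ with $\mathsf{a}_{ij}>0$ iff $(i,j)$ is an edge and $\mathsf{a}_{ij}=0$ otherwise. Connected graph means undirected ($\mathsf{a}_{ij}=\mathsf{a}_{ji}$) with a path between every pair of nodes. A differentiable $f$ is strictly convex iff $(z-x)^\top(\nabla f(z)-\nabla f(x))>0$ for all $x\ne z$. *)

theory Defs
  imports "HOL-Analysis.Analysis"
begin

definition gradient :: "('a::real_inner \<Rightarrow> real) \<Rightarrow> 'a \<Rightarrow> 'a"
  where "gradient f x = (THE g. GDERIV f x :> g)"

lemma gradient_eqI:
  assumes "GDERIV f x :> g"
  shows "gradient f x = g"
proof -
  have "h = g" if "GDERIV f x :> h" for h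
  proof -
    have "(\<lambda>y. y \<bullet> h) = (\<lambda>y. y \<bullet> g)"
      using that assms unfolding gderiv_def by (rule has_derivative_unique)
    then have "\<forall>y. y \<bullet> h = y \<bullet> g"
      by (simp add: fun_eq_iff)
    then show ?thesis
      by (simp only: vector_eq_ldot)
  qed
  then show ?thesis
    unfolding gradient_def by (intro the_equality assms)
qed

lemma GDERIV_gradient:
  fixes f :: "'a::euclidean_space \<Rightarrow> real"
  assumes "f differentiable at x"
  shows "GDERIV f x :> gradient f x"
proof -
  obtain D where D: "(f has_derivative D) (at x)"
    using assms unfolding differentiable_def by blast
  then interpret D: bounded_linear D
    by (rule has_derivative_bounded_linear)
  have "D = (\<lambda>y. y \<bullet> (\<Sum>b\<in>Basis. D b *\<^sub>R b))"
  proof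
    fix y
    have "D y = D (\<Sum>b\<in>Basis. (y \<bullet> b) *\<^sub>R b)"
      by (simp add: euclidean_representation)
    also have "\<dots> = y \<bullet> (\<Sum>b\<in>Basis. D b *\<^sub>R b)"
      by (simp add: D.sum D.scaleR inner_sum_right)
       (simp add: mult.commute)
    finally show "D y = y \<bullet> (\<Sum>b\<in>Basis. D b *\<^sub>R b)" .
  qed
  with D have "GDERIV f x :> (\<Sum>b\<in>Basis. D b *\<^sub>R b)"
    unfolding gderiv_def by simp
  then show ?thesis
    by (simp only: gradient_eqI)
qed

text \<open>Strict convexity of a differentiable function, in gradient form; the definition is
  meaningful only for functions that are differentiable everywhere.\<close>

definition strictly_convex :: "('a::real_inner \<Rightarrow> real) \<Rightarrow> bool"
  where "strictly_convex f \<longleftrightarrow>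
    (\<forall>x z. x \<noteq> z \<longrightarrow> (z - x) \<bullet> (gradient f z - gradient f x) > 0)"

text \<open>A weighted graph is given by its nonnegative adjacency matrix, with node set the finite
  index type \<open>'n\<close>, so that \<open>N = CARD('n)\<close>. Diagonal entries are unconstrained: a self-loop does
  not contribute to the dynamics below.\<close>

definition edges :: "real ^ 'n ^ 'n \<Rightarrow> ('n \<times> 'n) set"
  where "edges A = {(i, j). A $ i $ j > 0}"

definition connected_weighted_graph :: "real ^ 'n ^ 'n \<Rightarrow> bool"
  where "connected_weighted_graph A \<longleftrightarrow>
    (\<forall>i j. A $ i $ j \<ge> 0) \<and>
    (\<forall>i j. A $ i $ j = A $ j $ i) \<and>
    (\<forall>i j. (i, j) \<in> (edges A)\<^sup>*)"

text \<open>Trajectories on the closed half-line; the derivative at \<open>t = 0\<close> is one-sided.\<close>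

definition is_trajectory ::
  "real ^ 'n ^ 'n \<Rightarrow> ('n \<Rightarrow> real ^ 'd \<Rightarrow> real) \<Rightarrow> real \<Rightarrow> real \<Rightarrow>
    ('n \<Rightarrow> real \<Rightarrow> real ^ 'd) \<Rightarrow> ('n \<Rightarrow> real \<Rightarrow> real ^ 'd) \<Rightarrow> bool"
  where "is_trajectory A f \<alpha> \<beta> x v \<longleftrightarrow>
    (\<forall>i. \<forall>t\<ge>0.
      (v i has_vector_derivative
        (\<alpha> * \<beta>) *\<^sub>R (\<Sum>j\<in>UNIV. (A $ i $ j) *\<^sub>R (x i t - x j t)))
        (at t within {0..}) \<and>
      (x i has_vector_derivative
        - (\<alpha> *\<^sub>R gradient (f i) (x i t))
        - \<beta> *\<^sub>R (\<Sum>j\<in>UNIV. (A $ i $ j) *\<^sub>R (x i t - x j t)) - v i t)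
        (at t within {0..}))"

end

theory Submission
  imports Defs "HOL-Complex_Analysis.Great_Picard"
begin

text \<open>Let \<open>X\<close> be the consensus vector with all entries \<open>xstar\<close> and \<open>V*\<close> the dual vector
  \<open>-\<alpha> (gradient (f i) xstar)\<^sub>i\<close>, whose entries sum to zero. On the invariant subspace where
  \<open>v\<close> has zero sum, \<open>|x - X|\<^sup>2 / 2 + \<langle>K (v - V*), v - V*\<rangle> / (2 \<alpha> \<beta>)\<close>, with \<open>K\<close> a positive definite
  generalized inverse of the Laplacian \<open>L\<close>, decreases at the rate
  \<open>\<alpha> \<langle>x - X, \<nabla>F x - \<nabla>F X\<rangle> + \<beta> \<langle>L x, x\<rangle>\<close>, where \<open>\<nabla>F\<close> stacks the gradients of the \<open>f i\<close>. This rate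
  is a continuous function of \<open>x\<close> that is positive off \<open>X\<close>: where \<open>\<langle>L x, x\<rangle>\<close> vanishes, \<open>x\<close> is a
  consensus vector, and strict convexity of the sum applies. Since \<open>x\<close> is bounded and Lipschitz in
  time, each excursion away from \<open>X\<close> costs a fixed amount of the Lyapunov function, so \<open>x\<close> tends
  to \<open>X\<close>.

  Gradients of convex functions are continuous but in general not Lipschitz, so global existence is
  obtained from Peano's theorem for the vector field multiplied by a scalar cut-off. The cut-off
  preserves the decrease of the Lyapunov function, which confines the solution to the region where
  the cut-off is 1.\<close>

section \<open>Peano existence for bounded continuous vector fields\<close>

text \<open>Increments are integrals of a function bounded by \<open>M\<close>. Left of
  \<open>a\<close> the interval is empty and the integral is 0, so the estimate extends to the whole
  line, where delayed arguments may fall.\<close>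

lemma lipschitz_on_indefinite_integral:
  fixes g :: "real \<Rightarrow> 'a::euclidean_space"
  assumes cont: "continuous_on UNIV g" and bound: "\<And>s. norm (g s) \<le> M"
  shows "M-lipschitz_on UNIV (\<lambda>t. integral {a..t} g)"
proof -
  have M: "M \<ge> 0"
    using norm_ge_zero bound by (rule order_trans)
  have int: "g integrable_on {c..d}" for c d
    by (rule integrable_continuous_real) (rule continuous_on_subset[OF cont], simp)
  have *: "norm (integral {c..d} g) \<le> M * (d - c)" if "c \<le> d" for c d
    using integral_bound[of c d g M] that bound continuous_on_subset[OF cont] by simp
  have le: "norm (integral {a..t} g - integral {a..s} g) \<le> M * (t - s)" if "s \<le> t" for s t
  proof (cases "a \<le> s")
    case True
    then have "integral {a..s} g + integral {s..t} g = integral {a..t} g"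
      using that int by (intro Henstock_Kurzweil_Integration.integral_combine) auto
    then have "integral {a..t} g - integral {a..s} g = integral {s..t} g"
      by (simp add: algebra_simps)
    then show ?thesis
      using *[OF that] by simp
  next
    case False
    show ?thesis
    proof (cases "a \<le> t")
      case True
      have "norm (integral {a..t} g) \<le> M * (t - a)"
        by (rule *[OF True])
      also have "\<dots> \<le> M * (t - s)"
        using False M by (intro mult_left_mono) auto
      finally show ?thesis
        using False by simp
    next
      case outside: False
      then show ?thesis
        using False M that by simp
    qed
  qed
  show ?thesis
  proof (rule lipschitz_onI)
    fix s t :: real
    show "dist (integral {a..s} g) (integral {a..t} g) \<le> M * dist s t"
      using le[of s t] le[of t s] by (cases "s \<le> t") (auto simp: dist_norm norm_minus_commute)
  qed (rule M)
qed

text \<open>Method of steps: up to time \<open>(k + 1) * h\<close> the right-hand side reads the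
  solution only up to \<open>k * h\<close>. The Lipschitz constant \<open>M\<close> depends neither
  on \<open>h\<close> nor on \<open>k\<close>, which gives compactness as \<open>h\<close>
  shrinks.\<close>

lemma delay_equation_solution:
  fixes G :: "'a::euclidean_space \<Rightarrow> 'a"
  assumes G: "continuous_on UNIV G" "\<And>y. norm (G y) \<le> M" and h: "h > 0"
  shows "\<exists>u. M-lipschitz_on UNIV u \<and> (\<forall>t\<le>0. u t = z0) \<and>
    (\<forall>t\<le>real k * h. u t = z0 + integral {0..t} (\<lambda>s. G (u (s - h))))"
proof (induction k)
  case 0
  have "M \<ge> 0"
    using norm_ge_zero G(2) by (rule order_trans)
  then have "M-lipschitz_on UNIV (\<lambda>t::real. z0)"
    by (intro lipschitz_onI) auto
  moreover have "integral {0..t} F = 0" if "t \<le> 0" for t and F :: "real \<Rightarrow> 'a"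
    using that by (cases "t = 0") auto
  ultimately show ?case
    by (intro exI[of _ "\<lambda>t. z0"]) auto
next
  case (Suc k)
  then obtain u where u: "M-lipschitz_on UNIV u" "\<And>t. t \<le> 0 \<Longrightarrow> u t = z0"
    "\<And>t. t \<le> real k * h \<Longrightarrow> u t = z0 + integral {0..t} (\<lambda>s. G (u (s - h)))"
    by blast
  \<comment> \<open>One more step: integrate along the old \<open>u\<close>. Both functions agree up
    to \<open>k * h\<close>, so replacing \<open>u\<close> by \<open>w\<close> under the delay
    changes nothing up to \<open>(k + 1) * h\<close>.\<close>
  define w where "w t = z0 + integral {0..t} (\<lambda>s. G (u (s - h)))" for t
  have cont: "continuous_on UNIV (\<lambda>s. G (u (s - h)))"
    by (intro continuous_on_compose2[OF G(1)] continuous_on_compose2[OF lipschitz_on_continuous_on[OF u(1)]]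
          continuous_intros) auto
  have "M-lipschitz_on UNIV w"
    using lipschitz_on_indefinite_integral[OF cont G(2), of 0]
    unfolding w_def lipschitz_on_def by (simp add: dist_norm)
  moreover have "w t = z0" if "t \<le> 0" for t
    using that unfolding w_def by (cases "t = 0") auto
  moreover have "w t = z0 + integral {0..t} (\<lambda>s. G (w (s - h)))" if "t \<le> real (Suc k) * h" for t
  proof -
    have "integral {0..t} (\<lambda>s. G (u (s - h))) = integral {0..t} (\<lambda>s. G (w (s - h)))"
    proof (rule integral_cong)
      fix s assume "s \<in> {0..t}"
      with that have "s - h \<le> real k * h"
        by (simp add: algebra_simps)
      from u(3)[OF this] show "G (u (s - h)) = G (w (s - h))"
        by (simp add: w_def)
    qed
    then show ?thesis
      by (simp add: w_def)
  qed
  ultimately show ?case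
    by blast
qed

text \<open>A pointwise form of Arzela-Ascoli: a diagonal subsequence converges at all rationals,
  and the common Lipschitz constant carries the Cauchy property to every real time.\<close>

lemma lipschitz_pointwise_convergent_subsequence:
  fixes u :: "nat \<Rightarrow> real \<Rightarrow> 'a::euclidean_space"
  assumes lip: "\<And>n. M-lipschitz_on UNIV (u n)" and u0: "\<And>n. u n 0 = z0"
  shows "\<exists>r z. strict_mono (r :: nat \<Rightarrow> nat) \<and> (\<forall>t. (\<lambda>n. u (r n) t) \<longlonglongrightarrow> z t)"
proof -
  have M: "M \<ge> 0"
    using lip[of 0] by (rule lipschitz_on_nonneg)
  have lipD: "dist (u n s) (u n t) \<le> M * dist s t" for n s t
    using lip by (rule lipschitz_onD) auto
  \<comment> \<open>Rescaling by the reciprocal of a bound on the growth in \<open>t\<close> makes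
    the family uniformly bounded by 1, as the diagonal argument requires.\<close>
  define c where "c t = inverse (norm z0 + M * \<bar>t\<bar> + 1)" for t
  have c_pos: "c t > 0" for t
    using M unfolding c_def by (simp add: add_nonneg_pos)
  have bound: "norm (c t *\<^sub>R u n t) \<le> 1" for n t
  proof -
    have "norm (u n t) \<le> norm z0 + M * \<bar>t\<bar>"
      using lipD[of n t 0] norm_triangle_sub[of "u n t" z0] by (simp add: u0 dist_norm)
    then have "norm (u n t) \<le> inverse (c t)"
      by (simp add: c_def)
    then have "c t * norm (u n t) \<le> c t * inverse (c t)"
      using c_pos[of t] by (intro mult_left_mono) auto
    then show ?thesis
      using c_pos[of t] by simp
  qed
  obtain r :: "nat \<Rightarrow> nat" where r: "strict_mono r"
    and conv: "\<And>t. t \<in> \<rat> \<Longrightarrow> \<exists>l. (\<lambda>n. c t *\<^sub>R u (r n) t) \<longlonglongrightarrow> l"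
    by (rule function_convergent_subsequence[OF countable_rat,
          of "\<lambda>n t. c t *\<^sub>R u n t" 1]) (use bound in auto)
  have Cauchy_rat: "Cauchy (\<lambda>n. u (r n) q)" if "q \<in> \<rat>" for q
  proof -
    obtain l where "(\<lambda>n. c q *\<^sub>R u (r n) q) \<longlonglongrightarrow> l"
      using conv \<open>q \<in> \<rat>\<close> by blast
    then have "(\<lambda>n. inverse (c q) *\<^sub>R (c q *\<^sub>R u (r n) q)) \<longlonglongrightarrow> inverse (c q) *\<^sub>R l"
      by (intro tendsto_intros)
    then show ?thesis
      using c_pos[of q] by (intro LIMSEQ_imp_Cauchy[of _ "inverse (c q) *\<^sub>R l"]) simp
  qed
  have "Cauchy (\<lambda>n. u (r n) t)" for t
  proof (rule metric_CauchyI)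
    fix e :: real assume e: "e > 0"
    \<comment> \<open>Moving from \<open>t\<close> to a rational within \<open>d\<close> costs at
      most \<open>e / 3\<close>; \<open>M + 1\<close> guards against \<open>M = 0\<close>.\<close>
    define d where "d = e / (3 * (M + 1))"
    have "d > 0"
      using e M by (simp add: d_def)
    then obtain q where q: "q \<in> \<rat>" "t < q" "q < t + d"
      using Rats_dense_in_real[of t "t + d"] by auto
    have "M * dist t q \<le> (M + 1) * d"
      using q M by (intro mult_mono) (auto simp: dist_real_def)
    also have "\<dots> = e / 3"
      using M by (simp add: d_def field_simps)
    finally have near: "dist (u n t) (u n q) \<le> e / 3" for n
      using lipD[of n t q] by linarith
    obtain N where N: "\<And>m n. m \<ge> N \<Longrightarrow> n \<ge> N \<Longrightarrow> dist (u (r m) q) (u (r n) q) < e / 3"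
      using metric_CauchyD[OF Cauchy_rat[OF q(1)], of "e / 3"] e by auto
    have "dist (u (r m) t) (u (r n) t) < e" if "m \<ge> N" "n \<ge> N" for m n
    proof -
      have "dist (u (r m) t) (u (r n) t) \<le> dist (u (r m) t) (u (r m) q)
          + dist (u (r m) q) (u (r n) q) + dist (u (r n) t) (u (r n) q)"
        by (metis add.commute add_left_mono dist_triangle dist_triangle_le)
      then show ?thesis
        using near[of "r m"] near[of "r n"] N[OF that] by linarith
    qed
    then show "\<exists>N. \<forall>m\<ge>N. \<forall>n\<ge>N. dist (u (r m) t) (u (r n) t) < e"
      by blast
  qed
  then have "(\<lambda>n. u (r n) t) \<longlonglongrightarrow> lim (\<lambda>n. u (r n) t)" for t
    by (simp add: Cauchy_convergent convergent_LIMSEQ_iff[symmetric])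
  with r show ?thesis
    by (intro exI[of _ r] exI[of _ "\<lambda>t. lim (\<lambda>n. u (r n) t)"]) auto
qed

text \<open>Tonelli's scheme: solutions of the equation delayed by \<open>h\<close> are explicit, and a pointwise
  convergent subsequence for \<open>h \<longlongrightarrow> 0\<close> passes to the limit by dominated convergence.\<close>

lemma peano_existence_bounded:
  fixes G :: "'a::euclidean_space \<Rightarrow> 'a"
  assumes cont: "continuous_on UNIV G" and bound: "\<And>y. norm (G y) \<le> M"
  obtains z where "z 0 = z0"
    "\<And>t. t \<ge> 0 \<Longrightarrow> (z has_vector_derivative G (z t)) (at t within {0..})"
proof -
  define h where "h n = inverse (real (Suc n))" for n
  have h: "h n > 0" for n
    by (simp add: h_def)
  \<comment> \<open>\<open>Suc n * Suc n\<close> steps of length \<open>1 / Suc n\<close> reach time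
    \<open>Suc n\<close>: the delay tends to 0 while the horizon tends to infinity.\<close>
  have "\<exists>u. M-lipschitz_on UNIV u \<and> (\<forall>t\<le>0. u t = z0) \<and>
      (\<forall>t\<le>real (Suc n * Suc n) * h n. u t = z0 + integral {0..t} (\<lambda>s. G (u (s - h n))))" for n
    by (rule delay_equation_solution[OF cont bound h])
  then obtain u where lip: "\<And>n. M-lipschitz_on UNIV (u n)" and u0: "\<And>n t. t \<le> 0 \<Longrightarrow> u n t = z0"
    and "\<And>n t. t \<le> real (Suc n * Suc n) * h n \<Longrightarrow>
      u n t = z0 + integral {0..t} (\<lambda>s. G (u n (s - h n)))"
    by metis
  moreover have "real (Suc n * Suc n) * h n = real (Suc n)" for n
    unfolding h_def of_nat_mult by (simp add: field_simps)
  ultimately have eq: "\<And>n t. t \<le> real (Suc n) \<Longrightarrow> u n t = z0 + integral {0..t} (\<lambda>s. G (u n (s - h n)))"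
    by metis
  have M: "M \<ge> 0"
    using lip[of 0] by (rule lipschitz_on_nonneg)
  obtain r z where r: "strict_mono (r :: nat \<Rightarrow> nat)" and z: "\<And>t. (\<lambda>n. u (r n) t) \<longlonglongrightarrow> z t"
    using lipschitz_pointwise_convergent_subsequence[where u = u, OF lip u0[OF order_refl]] by blast
  have "h \<longlonglongrightarrow> 0"
    unfolding h_def by (rule LIMSEQ_inverse_real_of_nat)
  then have hr: "(\<lambda>n. h (r n)) \<longlonglongrightarrow> 0"
    using r by (auto dest: LIMSEQ_subseq_LIMSEQ simp: o_def)
  \<comment> \<open>By the common Lipschitz constant the delay changes the value by at most
    \<open>M * h (r n)\<close>.\<close>
  have delayed: "(\<lambda>n. u (r n) (s - h (r n))) \<longlonglongrightarrow> z s" for s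
  proof -
    have "(\<lambda>n. u (r n) (s - h (r n)) - u (r n) s) \<longlonglongrightarrow> 0"
    proof (rule Lim_null_comparison)
      show "\<forall>\<^sub>F n in sequentially. norm (u (r n) (s - h (r n)) - u (r n) s) \<le> M * h (r n)"
        using lipschitz_onD[OF lip, of "s - h (r n)" s "r n" for n] h
        by (intro always_eventually) (simp add: dist_norm less_imp_le)
      show "(\<lambda>n. M * h (r n)) \<longlonglongrightarrow> 0"
        using tendsto_mult[OF tendsto_const hr] by simp
    qed
    from tendsto_add[OF this z[of s]] show ?thesis
      by simp
  qed
  have zeq: "z t = z0 + integral {0..t} (\<lambda>s. G (z s))" for t
  proof -
    have contn: "continuous_on UNIV (\<lambda>s. G (u (r n) (s - h (r n))))" for n
      by (intro continuous_on_compose2[OF cont]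
          continuous_on_compose2[OF lipschitz_on_continuous_on[OF lip]] continuous_intros) auto
    have Glim: "(\<lambda>n. G (u (r n) (s - h (r n)))) \<longlonglongrightarrow> G (z s)" for s
      using delayed[of s] cont
      by (metis UNIV_I continuous_on_eq_continuous_at isCont_tendsto_compose open_UNIV)
    have "(\<lambda>n. integral {0..t} (\<lambda>s. G (u (r n) (s - h (r n))))) \<longlonglongrightarrow> integral {0..t} (\<lambda>s. G (z s))"
    proof (rule dominated_convergence(2)[where h = "\<lambda>_. M"])
      show "(\<lambda>s. G (u (r n) (s - h (r n)))) integrable_on {0..t}" for n
        by (rule integrable_continuous_real) (rule continuous_on_subset[OF contn], simp)
    qed (use bound Glim in auto)
    then have "(\<lambda>n. z0 + integral {0..t} (\<lambda>s. G (u (r n) (s - h (r n))))) \<longlonglongrightarrow>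
        z0 + integral {0..t} (\<lambda>s. G (z s))"
      by (intro tendsto_intros)
    moreover have "\<forall>\<^sub>F n in sequentially.
        z0 + integral {0..t} (\<lambda>s. G (u (r n) (s - h (r n)))) = u (r n) t"
    proof -
      obtain N where N: "t \<le> real N"
        using real_arch_simple by blast
      have "t \<le> real (Suc (r n))" if "n \<ge> N" for n
        using N that seq_suble[OF r, of n] by linarith
      then show ?thesis
        using eq by (intro eventually_sequentiallyI[of N]) auto
    qed
    ultimately have "(\<lambda>n. u (r n) t) \<longlonglongrightarrow> z0 + integral {0..t} (\<lambda>s. G (z s))"
      by (rule Lim_transform_eventually)
    with z show ?thesis
      by (rule LIMSEQ_unique)
  qed
  have z_lip: "dist (z s) (z t) \<le> M * dist s t" for s t
    using lipschitz_onD[OF lip] by (intro LIMSEQ_le_const2[OF tendsto_dist[OF z z]]) auto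
  have z_cont: "continuous_on S z" for S
    by (rule lipschitz_on_continuous_on[of M]) (use z_lip M in \<open>auto intro: lipschitz_onI\<close>)
  have Gz_cont: "continuous_on S (\<lambda>s. G (z s))" for S
    by (intro continuous_on_compose2[OF cont] z_cont) auto
  show ?thesis
  proof (rule that)
    show "z 0 = z0"
      using zeq[of 0] by simp
    fix t :: real assume t: "t \<ge> 0"
    \<comment> \<open>Ending the interval at \<open>t + 1\<close> keeps \<open>t\<close> off its
      right end, so that near \<open>t\<close> it coincides with \<open>{0..}\<close>.\<close>
    have "((\<lambda>t. integral {0..t} (\<lambda>s. G (z s))) has_vector_derivative G (z t)) (at t within {0..t+1})"
      by (rule integral_has_vector_derivative[OF Gz_cont]) (use t in auto)
    then have "((\<lambda>t. z0 + integral {0..t} (\<lambda>s. G (z s))) has_vector_derivative G (z t))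
        (at t within {0..t+1})"
      by (auto intro!: derivative_eq_intros)
    then have "(z has_vector_derivative G (z t)) (at t within {0..t+1})"
      by (simp only: zeq[symmetric])
    moreover have "at t within {0..t+1} = at t within {0..}"
      by (rule at_within_nhd[of _ "{..<t+1}"]) auto
    ultimately show "(z has_vector_derivative G (z t)) (at t within {0..})"
      by simp
  qed
qed

section \<open>Gradients of convex functions\<close>

text \<open>Restriction to the line through \<open>x\<close> and \<open>y\<close> reduces this to
  the tangent at 0 of a convex function of one variable, compared at 1.\<close>

lemma convex_gradient_inequality:
  fixes f :: "'a::euclidean_space \<Rightarrow> real"
  assumes conv: "convex_on UNIV f" and diff: "f differentiable at x"
  shows "f x + gradient f x \<bullet> (y - x) \<le> f y"
proof -
  define g where "g t = f (x + t *\<^sub>R (y - x))" for t :: real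
  have g_conv: "convex_on UNIV g"
  proof (rule convex_onI)
    fix t a b :: real assume "0 < t" "t < 1"
    moreover have "x + ((1 - t) *\<^sub>R a + t *\<^sub>R b) *\<^sub>R (y - x) =
        (1 - t) *\<^sub>R (x + a *\<^sub>R (y - x)) + t *\<^sub>R (x + b *\<^sub>R (y - x))"
      by (simp add: algebra_simps)
    ultimately show "g ((1 - t) *\<^sub>R a + t *\<^sub>R b) \<le> (1 - t) * g a + t * g b"
      using convex_onD[OF conv, of t] unfolding g_def by simp
  qed simp
  have "(f has_derivative (\<lambda>h. h \<bullet> gradient f x)) (at (x + 0 *\<^sub>R (y - x)))"
    using GDERIV_gradient[OF diff] by (simp add: gderiv_def)
  moreover have "((\<lambda>t. x + t *\<^sub>R (y - x)) has_derivative (\<lambda>t. t *\<^sub>R (y - x))) (at (0::real))"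
    by (auto intro!: derivative_eq_intros)
  ultimately have "(g has_derivative (\<lambda>t. (t *\<^sub>R (y - x)) \<bullet> gradient f x)) (at 0)"
    unfolding g_def by (rule has_derivative_compose[rotated])
  then have "(g has_field_derivative (y - x) \<bullet> gradient f x) (at 0 within UNIV)"
    by (simp add: has_field_derivative_def mult.commute[of _ "(y - x) \<bullet> gradient f x"] mult_commute_abs)
  from convex_on_imp_above_tangent[OF g_conv _ _ _ this, of 1]
  show ?thesis
    by (simp add: g_def inner_commute)
qed

lemma convex_gradient_monotone:
  fixes f :: "'a::euclidean_space \<Rightarrow> real"
  assumes "convex_on UNIV f" and "\<And>x. f differentiable at x"
  shows "(x - y) \<bullet> (gradient f x - gradient f y) \<ge> 0"
  using convex_gradient_inequality[OF assms, of x y] convex_gradient_inequality[OF assms, of y x]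
  by (simp add: inner_commute inner_diff_left inner_diff_right)

text \<open>If the gradient at a nearby \<open>y\<close> differed much from that at
  \<open>x\<close>, the gradient inequality would make \<open>f\<close> grow along the difference
  faster than its first-order expansion at \<open>x\<close> permits.\<close>

lemma convex_gradient_continuous:
  fixes f :: "'a::euclidean_space \<Rightarrow> real"
  assumes conv: "convex_on UNIV f" and diff: "\<And>x. f differentiable at x"
  shows "continuous_on UNIV (gradient f)"
proof -
  have "isCont (gradient f) x" for x
    unfolding continuous_at_eps_delta
  proof (intro allI impI)
    fix e :: real assume e: "e > 0"
    define g where "g = gradient f x"
    have "(f has_derivative (\<lambda>h. h \<bullet> g)) (at x)"
      using GDERIV_gradient[OF diff] by (simp add: gderiv_def g_def)
    then obtain d where d: "d > 0"
      "\<And>y. norm (y - x) < d \<Longrightarrow> norm (f y - f x - (y - x) \<bullet> g) \<le> e / 4 * norm (y - x)"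
      unfolding has_derivative_at_alt using e by (meson divide_pos_pos zero_less_numeral)
    \<comment> \<open>For \<open>y\<close> within \<open>c\<close> of \<open>x\<close> and a step
      \<open>u\<close> of length \<open>c\<close>, the point \<open>y + u\<close> is within
      \<open>2 * c < d\<close> of \<open>x\<close>, where the expansion is valid.\<close>
    define c where "c = d / 3"
    have c: "c > 0"
      using d by (simp add: c_def)
    have "norm (gradient f y - g) < e" if y: "norm (y - x) < c" for y
    proof (cases "gradient f y = g")
      case False
      define w where "w = gradient f y - g"
      have w: "norm w > 0"
        using False by (simp add: w_def)
      define u where "u = (c / norm w) *\<^sub>R w"
      have u: "norm u = c" "w \<bullet> u = c * norm w"
        using w c by (auto simp: u_def power2_norm_eq_inner[symmetric] power2_eq_square)
      have yu: "norm (y + u - x) \<le> 2 * c"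
        using norm_triangle_ineq[of "y - x" u] y u by (simp add: algebra_simps)
      have "norm (f (y + u) - f x - (y + u - x) \<bullet> g) \<le> e / 4 * norm (y + u - x)"
        using yu c by (intro d(2)) (simp add: c_def)
      also have "\<dots> \<le> e / 4 * (2 * c)"
        using yu e by (intro mult_left_mono) auto
      finally have "f (y + u) - f x - (y + u - x) \<bullet> g \<le> e / 2 * c"
        unfolding real_norm_def by linarith
      moreover have "f x + g \<bullet> (y - x) \<le> f y"
        unfolding g_def by (rule convex_gradient_inequality[OF conv diff])
      moreover have "f y + gradient f y \<bullet> u \<le> f (y + u)"
        using convex_gradient_inequality[OF conv diff, of y "y + u"] by simp
      \<comment> \<open>\<open>f (y + u)\<close> is bounded below through \<open>y\<close> and above
        through \<open>x\<close>; all but the inner product of \<open>w\<close> and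
        \<open>u\<close>, which is \<open>c * norm w\<close>, cancels.\<close>
      ultimately have "w \<bullet> u \<le> e / 2 * c"
        by (simp add: w_def inner_diff_left inner_diff_right inner_add_right inner_commute)
      then have "norm w \<le> e / 2"
        using u c by (simp add: mult.commute)
      then show ?thesis
        using e by (simp add: w_def)
    qed (use e in simp)
    then show "\<exists>d>0. \<forall>x'. dist x' x < d \<longrightarrow> dist (gradient f x') (gradient f x) < e"
      using c by (auto simp: dist_norm g_def)
  qed
  then show ?thesis
    by (simp add: continuous_at_imp_continuous_on)
qed

lemma GDERIV_sum:
  assumes "\<And>i. i \<in> S \<Longrightarrow> GDERIV (f i) x :> g i"
  shows "GDERIV (\<lambda>y. \<Sum>i\<in>S. f i y) x :> (\<Sum>i\<in>S. g i)"
  using assms has_derivative_sum[of S f "\<lambda>i h. h \<bullet> g i" "at x"]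
  by (simp add: gderiv_def inner_sum_right)

lemma gradient_eq_0_at_minimum:
  fixes f :: "'a::euclidean_space \<Rightarrow> real"
  assumes "f differentiable at x" and "\<And>y. f x \<le> f y"
  shows "gradient f x = 0"
proof -
  have "(\<lambda>h. h \<bullet> gradient f x) = (\<lambda>h. 0)"
    using GDERIV_gradient[OF assms(1)] assms(2)
    by (intro differential_zero_maxmin[of x UNIV f]) (auto simp: gderiv_def)
  then show ?thesis
    by (metis inner_eq_zero_iff)
qed


section \<open>Lyapunov functions\<close>

text \<open>\<open>V\<close> is a function of time, so it may depend on further state components,
  such as the dual variable, whose convergence is not claimed; only its decay rate must be a
  function of \<open>x\<close>.\<close>

lemma lyapunov_tendsto:
  fixes x :: "real \<Rightarrow> 'a::euclidean_space" and V :: "real \<Rightarrow> real"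
  assumes der: "\<And>t. t \<ge> 0 \<Longrightarrow> (V has_vector_derivative - W (x t)) (at t within {0..})"
    and V_nonneg: "\<And>t. t \<ge> 0 \<Longrightarrow> V t \<ge> 0"
    and W: "continuous_on UNIV W" "\<And>y. W y \<ge> 0" "\<And>y. y \<noteq> p \<Longrightarrow> W y > 0"
    and bounded: "bounded (x ` {0..})" and lip: "M-lipschitz_on {0..} x"
  shows "(x \<longlongrightarrow> p) at_top"
proof -
  have drop: "V t \<le> V s - c * (t - s)"
    if "0 \<le> s" "s \<le> t" "\<And>u. s \<le> u \<Longrightarrow> u \<le> t \<Longrightarrow> W (x u) \<ge> c" for s t c
  proof -
    have W_int: "((\<lambda>u. W (x u)) has_integral - V t - (- V s)) {s..t}"
    proof (rule fundamental_theorem_of_calculus[OF that(2)])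
      fix u assume "u \<in> {s..t}"
      then have "(V has_vector_derivative - W (x u)) (at u within {s..t})"
        using der[of u] that(1) by (auto intro: has_vector_derivative_within_subset)
      from has_vector_derivative_minus[OF this]
      show "((\<lambda>u. - V u) has_vector_derivative W (x u)) (at u within {s..t})"
        by simp
    qed
    have "((\<lambda>u. c) has_integral c * (t - s)) {s..t}"
      using has_integral_const_real[of c s t] that(2) by (simp add: mult.commute)
    from has_integral_le[OF this W_int] have "c * (t - s) \<le> - V t - (- V s)"
      using that(3) by auto
    then show ?thesis
      by simp
  qed
  have M: "M \<ge> 0"
    using lip by (rule lipschitz_on_nonneg)
  show ?thesis
  proof (rule tendstoI)
    fix e :: real assume e: "e > 0"
    \<comment> \<open>On this compact set, which avoids \<open>p\<close>, the rate \<open>W\<close>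
      has a positive lower bound \<open>c\<close>.\<close>
    define K where "K = closure (x ` {0..}) - ball p (e / 2)"
    have "compact K"
      unfolding K_def using bounded by (intro compact_diff) auto
    obtain c where c: "c > 0" "\<And>y. y \<in> K \<Longrightarrow> W y \<ge> c"
    proof (cases "K = {}")
      case False
      obtain y where y: "y \<in> K" "\<And>y'. y' \<in> K \<Longrightarrow> W y \<le> W y'"
        using continuous_attains_inf[OF \<open>compact K\<close> False continuous_on_subset[OF W(1) subset_UNIV]]
        by auto
      moreover have "y \<noteq> p"
        using y(1) e by (auto simp: K_def)
      ultimately show ?thesis
        using that[of "W y"] W(3) by blast
    qed (use that[of 1] in auto)
    \<comment> \<open>In time \<open>d\<close> the curve moves at most \<open>e / 2\<close>. A point
      at distance \<open>e\<close> from \<open>p\<close> therefore starts a stay of length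
      \<open>d\<close> in \<open>K\<close>, which costs at least \<open>c * d\<close>; after
      \<open>T\<close> less than that is left above the infimum \<open>l\<close>.\<close>
    define d where "d = e / (2 * (M + 1))"
    have d: "d > 0"
      using e M by (simp add: d_def)
    have bdd: "bdd_below (V ` {0..})"
      using V_nonneg by (intro bdd_belowI[of _ 0]) auto
    define l where "l = Inf (V ` {0..})"
    have l_le: "l \<le> V t" if "t \<ge> 0" for t
      unfolding l_def using that bdd by (intro cInf_lower) auto
    obtain T where T: "T \<ge> 0" "V T < l + c * d"
      using cInf_lessD[of "V ` {0..}" "l + c * d"] c d by (auto simp: l_def)
    have "dist (x t) p < e" if "t \<ge> T" for t
    proof (rule ccontr)
      assume far: "\<not> dist (x t) p < e"
      have t: "t \<ge> 0"
        using that T by simp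
      have "W (x u) \<ge> c" if u: "t \<le> u" "u \<le> t + d" for u
      proof (rule c(2))
        have "dist (x t) (x u) \<le> M * dist t u"
          using lip by (rule lipschitz_onD) (use t u in auto)
        also have "\<dots> \<le> M * d"
          using M u by (intro mult_left_mono) (auto simp: dist_real_def)
        also have "\<dots> \<le> (M + 1) * d"
          using d by (intro mult_right_mono) auto
        also have "\<dots> = e / 2"
          using M by (simp add: d_def field_simps)
        finally have "dist p (x u) \<ge> e / 2"
          using far dist_triangle[of "x t" p "x u"] by (simp add: dist_commute)
        then show "x u \<in> K"
          using t u closure_subset by (fastforce simp: K_def)
      qed
      then have "V (t + d) \<le> V t - c * d"
        using drop[of t "t + d" c] t d by simp
      moreover have "V t \<le> V T"
        using drop[of T t 0] W(2) T that by simp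
      moreover have "l \<le> V (t + d)"
        using t d by (intro l_le) simp
      ultimately show False
        using T by linarith
    qed
    then show "\<forall>\<^sub>F t in at_top. dist (x t) p < e"
      by (auto simp: eventually_at_top_linorder)
  qed
qed

text \<open>The quadratic form attains a positive minimum on the compact unit sphere, and
  homogeneity of degree 2 extends the bound.\<close>

lemma positive_definite_coercive:
  fixes K :: "'a::euclidean_space \<Rightarrow> 'a"
  assumes lin: "linear K" and pos: "\<And>y. y \<noteq> 0 \<Longrightarrow> K y \<bullet> y > 0"
  obtains c where "c > 0" "\<And>y. c * (norm y)\<^sup>2 \<le> K y \<bullet> y"
proof -
  have cont: "continuous_on (sphere 0 1) (\<lambda>y. K y \<bullet> y)"
    using linear_continuous_on[of K] lin by (auto intro!: continuous_intros simp: linear_conv_bounded_linear)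
  have "sphere 0 1 \<noteq> ({} :: 'a set)"
    by simp
  then obtain w where w: "norm w = 1" "\<And>y. norm y = 1 \<Longrightarrow> K w \<bullet> w \<le> K y \<bullet> y"
    using continuous_attains_inf[OF compact_sphere _ cont] by auto
  show ?thesis
  proof (rule that)
    show "K w \<bullet> w > 0"
      by (rule pos) (use w(1) in auto)
    fix y
    show "K w \<bullet> w * (norm y)\<^sup>2 \<le> K y \<bullet> y"
    proof (cases "y = 0")
      case False
      then have "K w \<bullet> w \<le> K (sgn y) \<bullet> sgn y"
        by (intro w(2)) (simp add: norm_sgn)
      also have "\<dots> = (K y \<bullet> y) / (norm y)\<^sup>2"
        by (simp add: sgn_div_norm linear_scale[OF lin] power2_eq_square divide_inverse)
      finally show ?thesis
        using False by (simp add: field_simps)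
    qed (simp add: linear_0[OF lin])
  qed
qed

section \<open>The graph Laplacian\<close>

text \<open>The Kronecker product of the graph Laplacian with the identity of \<open>'a\<close>: it
  acts on one vector per node, and self-loops cancel in the differences.\<close>

definition laplacian :: "real ^ 'n ^ 'n \<Rightarrow> 'a::real_vector ^ 'n \<Rightarrow> 'a ^ 'n"
  where "laplacian A x = (\<chi> i. \<Sum>j\<in>UNIV. (A $ i $ j) *\<^sub>R (x $ i - x $ j))"

lemma linear_laplacian: "linear (laplacian A :: 'a::real_vector ^ 'n \<Rightarrow> 'a ^ 'n)"
proof (rule linearI)
  fix x y :: "'a ^ 'n" and c :: real
  show "laplacian A (x + y) = laplacian A x + laplacian A y"
    unfolding laplacian_def vec_eq_iff
    by (simp add: sum.distrib[symmetric] scaleR_add_right[symmetric] del: scaleR_add_right)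
       (simp add: algebra_simps)
  show "laplacian A (c *\<^sub>R x) = c *\<^sub>R laplacian A x"
    unfolding laplacian_def vec_eq_iff
    by (simp add: scaleR_sum_right scaleR_diff_right[symmetric] mult.commute del: scaleR_diff_right)
qed

text \<open>Exchanging \<open>i\<close> and \<open>j\<close> gives a second expression for the same
  double sum, with \<open>- y $ j\<close> for \<open>y $ i\<close>; adding the two produces the
  factor 2.\<close>

lemma inner_laplacian:
  fixes x y :: "'a::real_inner ^ 'n"
  assumes sym: "\<And>i j. A $ i $ j = A $ j $ i"
  shows "2 * (laplacian A x \<bullet> y) =
    (\<Sum>i\<in>UNIV. \<Sum>j\<in>UNIV. A $ i $ j * ((x $ i - x $ j) \<bullet> (y $ i - y $ j)))"
proof -
  have "laplacian A x \<bullet> y = (\<Sum>i\<in>UNIV. \<Sum>j\<in>UNIV. A $ i $ j * ((x $ i - x $ j) \<bullet> y $ i))"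
    by (simp add: laplacian_def inner_vec_def inner_sum_left)
  moreover have "(\<Sum>i\<in>UNIV. \<Sum>j\<in>UNIV. A $ i $ j * ((x $ i - x $ j) \<bullet> y $ i)) =
      (\<Sum>i\<in>UNIV. \<Sum>j\<in>UNIV. - (A $ i $ j * ((x $ i - x $ j) \<bullet> y $ j)))"
    by (subst sum.swap, intro sum.cong refl)
       (subst sym, simp add: inner_diff_left algebra_simps)
  ultimately have "2 * (laplacian A x \<bullet> y) =
      (\<Sum>i\<in>UNIV. \<Sum>j\<in>UNIV. A $ i $ j * ((x $ i - x $ j) \<bullet> y $ i)) +
      (\<Sum>i\<in>UNIV. \<Sum>j\<in>UNIV. - (A $ i $ j * ((x $ i - x $ j) \<bullet> y $ j)))"
    by simp
  also have "\<dots> = (\<Sum>i\<in>UNIV. \<Sum>j\<in>UNIV. A $ i $ j * ((x $ i - x $ j) \<bullet> (y $ i - y $ j)))"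
    by (simp add: sum.distrib[symmetric] inner_diff_right right_diff_distrib)
  finally show ?thesis .
qed

lemma laplacian_symmetric:
  fixes x y :: "'a::real_inner ^ 'n"
  assumes sym: "\<And>i j. A $ i $ j = A $ j $ i"
  shows "laplacian A x \<bullet> y = x \<bullet> laplacian A y"
  using inner_laplacian[of A x y] inner_laplacian[of A y x] sym
  by (simp add: inner_commute)

lemma sum_laplacian:
  fixes x :: "'a::real_inner ^ 'n"
  assumes sym: "\<And>i j. A $ i $ j = A $ j $ i"
  shows "(\<Sum>i\<in>UNIV. laplacian A x $ i) = 0"
proof -
  \<comment> \<open>Testing against the constant vector with value \<open>b\<close> gives 0, as its
    differences vanish, but also gives the square of \<open>b\<close>.\<close>
  define b where "b = (\<Sum>i\<in>UNIV. laplacian A x $ i)"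
  have "2 * (laplacian A x \<bullet> (\<chi> i. b)) = 0"
    using inner_laplacian[of A x "\<chi> i. b"] sym by simp
  then have "b \<bullet> b = 0"
    by (simp add: inner_vec_def b_def inner_sum_left)
  then show ?thesis
    by (simp add: b_def)
qed

lemma inner_laplacian_nonneg:
  fixes x :: "'a::real_inner ^ 'n"
  assumes "connected_weighted_graph A"
  shows "laplacian A x \<bullet> x \<ge> 0"
proof -
  have "2 * (laplacian A x \<bullet> x) \<ge> 0"
    using assms unfolding connected_weighted_graph_def
    by (subst inner_laplacian) (auto intro!: sum_nonneg)
  then show ?thesis
    by simp
qed

text \<open>A vanishing sum of nonnegative terms makes \<open>x\<close> agree across each edge, and
  connectedness propagates this along paths.\<close>

lemma inner_laplacian_eq_0_consensus:
  fixes x :: "'a::real_inner ^ 'n"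
  assumes A: "connected_weighted_graph A" and 0: "laplacian A x \<bullet> x = 0"
  shows "x $ i = x $ j"
proof -
  have nonneg: "A $ i $ j * ((x $ i - x $ j) \<bullet> (x $ i - x $ j)) \<ge> 0" for i j
    using A by (simp add: connected_weighted_graph_def)
  have "(\<Sum>i\<in>UNIV. \<Sum>j\<in>UNIV. A $ i $ j * ((x $ i - x $ j) \<bullet> (x $ i - x $ j))) = 0"
    using A inner_laplacian[of A x x] 0 by (simp add: connected_weighted_graph_def)
  then have zero: "A $ i $ j * ((x $ i - x $ j) \<bullet> (x $ i - x $ j)) = 0" for i j
    using nonneg by (simp add: sum_nonneg_eq_0_iff sum_nonneg)
  have edge: "x $ i = x $ j" if "(i, j) \<in> edges A" for i j
    using zero[of i j] that by (simp add: edges_def)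
  have "(i, j) \<in> (edges A)\<^sup>*"
    using A by (simp add: connected_weighted_graph_def)
  then show ?thesis
    by (induction rule: rtrancl_induct) (auto dest: edge)
qed

text \<open>The witness \<open>K\<close> is the inverse of \<open>x \<mapsto> laplacian A x + (\<chi> i. \<Sum>j. x $ j)\<close>; the added
  term removes the consensus kernel of the Laplacian without touching zero-sum vectors.\<close>

lemma laplacian_generalized_inverse:
  fixes A :: "real ^ 'n ^ 'n"
  assumes A: "connected_weighted_graph A"
  obtains K :: "'a::euclidean_space ^ 'n \<Rightarrow> 'a ^ 'n"
  where "linear K" "\<And>x y. K x \<bullet> y = x \<bullet> K y" "\<And>y. y \<noteq> 0 \<Longrightarrow> K y \<bullet> y > 0"
    "\<And>x y. (\<Sum>i\<in>UNIV. y $ i) = 0 \<Longrightarrow> K (laplacian A x) \<bullet> y = x \<bullet> y"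
proof -
  have sym: "A $ i $ j = A $ j $ i" for i j
    using A by (simp add: connected_weighted_graph_def)
  define J :: "'a ^ 'n \<Rightarrow> 'a ^ 'n" where "J x = (\<chi> i. \<Sum>j\<in>UNIV. x $ j)" for x
  define S where "S x = laplacian A x + J x" for x :: "'a ^ 'n"
  have "linear J"
    by (rule linearI) (simp_all add: J_def vec_eq_iff sum.distrib scaleR_sum_right)
  then have "linear S"
    unfolding S_def by (intro linear_compose_add linear_laplacian)
  have J: "J x \<bullet> y = (\<Sum>j\<in>UNIV. x $ j) \<bullet> (\<Sum>j\<in>UNIV. y $ j)" for x y
    by (simp add: J_def inner_vec_def inner_sum_right)
  have S_sym: "S x \<bullet> y = x \<bullet> S y" for x y
    unfolding S_def inner_add_left inner_add_right
    using laplacian_symmetric[of A x y] sym J[of x y] J[of y x] by (simp add: inner_commute)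
  have S_pos: "S x \<bullet> x > 0" if "x \<noteq> 0" for x
  proof -
    have nonneg: "laplacian A x \<bullet> x \<ge> 0" "J x \<bullet> x \<ge> 0"
      using inner_laplacian_nonneg[OF A, of x] by (simp_all add: J)
    have "S x \<bullet> x \<noteq> 0"
    \<comment> \<open>The Laplacian part forces consensus and the \<open>J\<close> part forces zero
      sum; together they give \<open>x = 0\<close>.\<close>
    proof
      assume "S x \<bullet> x = 0"
      then have eq: "laplacian A x \<bullet> x = 0" "J x \<bullet> x = 0"
        using nonneg by (simp_all add: S_def inner_add_left)
      have const: "x $ j = x $ i" for i j
        by (rule inner_laplacian_eq_0_consensus[OF A eq(1)])
      have "x $ i = 0" for i
      proof -
        have "(\<Sum>j\<in>UNIV. x $ j) = (\<Sum>j\<in>(UNIV :: 'n set). x $ i)"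
          by (intro sum.cong refl const)
        then show ?thesis
          using eq(2) by (simp add: J sum_constant_scaleR)
      qed
      with that show False
        by (simp add: vec_eq_iff)
    qed
    then show ?thesis
      using nonneg by (simp add: S_def inner_add_left)
  qed
  have "inj S"
    using S_pos by (subst linear_injective_0[OF \<open>linear S\<close>]) (metis inner_zero_left less_irrefl)
  then obtain K where K: "linear K" "\<And>x. K (S x) = x" "\<And>y. S (K y) = y"
    using linear_injective_isomorphism[OF \<open>linear S\<close>] by blast
  have K_sym: "K x \<bullet> y = x \<bullet> K y" for x y
    using S_sym[of "K x" "K y"] by (simp add: K)
  show ?thesis
  proof (rule that)
    show "K y \<bullet> y > 0" if "y \<noteq> 0" for y
    proof -
      have "K y \<noteq> 0"
        using K(3)[of y] that linear_0[OF \<open>linear S\<close>] by auto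
      then show ?thesis
        using S_pos[of "K y"] by (simp add: K inner_commute)
    qed
    fix x y :: "'a ^ 'n"
    assume y: "(\<Sum>i\<in>UNIV. y $ i) = 0"
    \<comment> \<open>Summing \<open>S w = y\<close> over the nodes removes the Laplacian and shows
      that \<open>w\<close> has zero sum, so \<open>laplacian A w = y\<close>; symmetry then moves
      both operators onto \<open>y\<close>.\<close>
    define w where "w = K y"
    have Sw: "laplacian A w + J w = y"
      using K(3)[of y] by (simp add: w_def S_def)
    then have "(\<Sum>i\<in>UNIV. (laplacian A w + J w) $ i) = 0"
      using y by simp
    then have "of_nat CARD('n) *\<^sub>R (\<Sum>j\<in>UNIV. w $ j) = 0"
      using sum_laplacian[of A w] sym by (simp add: sum.distrib J_def sum_constant_scaleR)
    then have "J w = 0"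
      by (simp add: J_def vec_eq_iff)
    with Sw have "laplacian A w = y"
      by simp
    then show "K (laplacian A x) \<bullet> y = x \<bullet> y"
      using laplacian_symmetric[of A x w] sym by (simp add: K_sym w_def)
  qed (fact K(1) K_sym)+
qed

lemma has_vector_derivative_vec_lambda:
  fixes x :: "'n::finite \<Rightarrow> real \<Rightarrow> 'a::euclidean_space"
  assumes "\<And>i. (x i has_vector_derivative x' i) F"
  shows "((\<lambda>t. \<chi> i. x i t) has_vector_derivative (\<chi> i. x' i)) F"
proof -
  have axis: "bounded_linear (axis i :: 'a \<Rightarrow> 'a ^ 'n)" for i
    by (intro linear_conv_bounded_linear[THEN iffD1] linearI) (auto simp: axis_def vec_eq_iff)
  have sum_axis: "(\<chi> i. c i) = (\<Sum>i\<in>UNIV. axis i (c i))" for c :: "'n \<Rightarrow> 'a"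
    by (simp add: vec_eq_iff axis_def)
  show ?thesis
    unfolding sum_axis
    by (intro has_vector_derivative_sum bounded_linear.has_vector_derivative[OF axis] assms)
qed

section \<open>The saddle-point dynamics\<close>

locale consensus_optimization =
  fixes A :: "real ^ 'n ^ 'n" and f :: "'n \<Rightarrow> real ^ 'd \<Rightarrow> real" and p :: "real ^ 'd"
    and \<alpha> \<beta> :: real
  assumes graph: "connected_weighted_graph A"
    and conv: "\<And>i. convex_on UNIV (f i)"
    and diff: "\<And>i y. f i differentiable at y"
    and strict: "strictly_convex (\<lambda>y. \<Sum>i\<in>UNIV. f i y)"
    and minimum: "\<And>y. (\<Sum>i\<in>UNIV. f i p) \<le> (\<Sum>i\<in>UNIV. f i y)"
    and \<alpha>: "\<alpha> > 0" and \<beta>: "\<beta> > 0"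
begin

definition grads :: "real ^ 'd ^ 'n \<Rightarrow> real ^ 'd ^ 'n"
  where "grads x = (\<chi> i. gradient (f i) (x $ i))"

definition optimum :: "real ^ 'd ^ 'n"
  where "optimum = (\<chi> i. p)"

text \<open>The dual part is the value that makes \<open>saddle_field\<close> vanish at
  \<open>optimum\<close>: it balances the local gradients, which sum to zero but need not vanish one
  by one.\<close>

definition equilibrium :: "(real ^ 'd ^ 'n) \<times> (real ^ 'd ^ 'n)"
  where "equilibrium = (optimum, - (\<alpha> *\<^sub>R grads optimum))"

definition saddle_field :: "(real ^ 'd ^ 'n) \<times> (real ^ 'd ^ 'n) \<Rightarrow> (real ^ 'd ^ 'n) \<times> (real ^ 'd ^ 'n)"
  where "saddle_field z = (- (\<alpha> *\<^sub>R grads (fst z)) - \<beta> *\<^sub>R laplacian A (fst z) - snd z,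
    (\<alpha> * \<beta>) *\<^sub>R laplacian A (fst z))"

definition dissipation :: "real ^ 'd ^ 'n \<Rightarrow> real"
  where "dissipation x = \<alpha> * ((x - optimum) \<bullet> (grads x - grads optimum))
    + \<beta> * (laplacian A (x - optimum) \<bullet> (x - optimum))"

text \<open>The time-dependent factor \<open>\<theta>\<close> lets the same computation serve the equation itself and its
  cut-off version, for which the Lyapunov function is still nonincreasing.\<close>

definition solves :: "(real \<Rightarrow> real) \<Rightarrow> (real \<Rightarrow> (real ^ 'd ^ 'n) \<times> (real ^ 'd ^ 'n)) \<Rightarrow> bool"
  where "solves \<theta> z \<longleftrightarrow>
    (\<forall>t\<ge>0. (z has_vector_derivative \<theta> t *\<^sub>R saddle_field (z t)) (at t within {0..}))"

section \<open>Stacked gradients, continuity and positivity of the dissipation\<close>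

lemma adjacency_symmetric: "A $ i $ j = A $ j $ i"
  using graph by (simp add: connected_weighted_graph_def)

lemma gradient_sum: "gradient (\<lambda>y. \<Sum>i\<in>UNIV. f i y) y = (\<Sum>i\<in>UNIV. gradient (f i) y)"
  by (intro gradient_eqI GDERIV_sum GDERIV_gradient diff)

lemma sum_gradient_minimum: "(\<Sum>i\<in>UNIV. gradient (f i) p) = 0"
proof -
  have "(\<lambda>y. \<Sum>i\<in>UNIV. f i y) differentiable at p"
    using diff by (intro differentiable_sum) auto
  then show ?thesis
    using gradient_eq_0_at_minimum[of "\<lambda>y. \<Sum>i\<in>UNIV. f i y" p] minimum by (simp add: gradient_sum)
qed

lemma laplacian_diff_optimum: "laplacian A (x - optimum) = laplacian A x"
  by (simp add: laplacian_def optimum_def)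

lemma continuous_on_laplacian: "continuous_on S (laplacian A :: real ^ 'd ^ 'n \<Rightarrow> _)"
  by (intro linear_continuous_on linear_conv_bounded_linear[THEN iffD1] linear_laplacian)

lemma continuous_on_grads: "continuous_on UNIV grads"
  unfolding grads_def
  by (intro continuous_on_vec_lambda continuous_on_compose2[OF convex_gradient_continuous[OF conv diff]]
      continuous_intros) auto

lemma continuous_on_saddle_field: "continuous_on UNIV saddle_field"
  unfolding saddle_field_def
  by (intro continuous_intros continuous_on_compose2[OF continuous_on_grads]
      continuous_on_compose2[OF continuous_on_laplacian]) auto

lemma continuous_on_dissipation: "continuous_on UNIV dissipation"
  unfolding dissipation_def
  by (intro continuous_intros continuous_on_compose2[OF continuous_on_grads]
      continuous_on_compose2[OF continuous_on_laplacian]) auto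

lemma grads_monotone: "(x - optimum) \<bullet> (grads x - grads optimum) \<ge> 0"
  by (subst inner_vec_def, intro sum_nonneg)
     (simp add: grads_def convex_gradient_monotone[OF conv diff])

lemma dissipation_nonneg: "dissipation x \<ge> 0"
  unfolding dissipation_def
  using \<alpha> \<beta> grads_monotone[of x] inner_laplacian_nonneg[OF graph, of "x - optimum"]
  by (intro add_nonneg_nonneg mult_nonneg_nonneg) auto

lemma dissipation_pos:
  assumes "x \<noteq> optimum"
  shows "dissipation x > 0"
proof -
  have "dissipation x \<noteq> 0"
  proof
    assume "dissipation x = 0"
    moreover have nonneg: "\<alpha> * ((x - optimum) \<bullet> (grads x - grads optimum)) \<ge> 0"
        "\<beta> * (laplacian A (x - optimum) \<bullet> (x - optimum)) \<ge> 0"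
      using \<alpha> \<beta> grads_monotone[of x] inner_laplacian_nonneg[OF graph, of "x - optimum"] by auto
    ultimately have "\<alpha> * ((x - optimum) \<bullet> (grads x - grads optimum)) = 0"
        "\<beta> * (laplacian A (x - optimum) \<bullet> (x - optimum)) = 0"
      unfolding dissipation_def by linarith+
    then have zero: "(x - optimum) \<bullet> (grads x - grads optimum) = 0"
        "laplacian A (x - optimum) \<bullet> (x - optimum) = 0"
      using \<alpha> \<beta> by auto
    define c where "c = x $ undefined"
    have x: "x $ i = c" for i
      using inner_laplacian_eq_0_consensus[OF graph zero(2), of i undefined]
      by (simp add: c_def optimum_def)
    have "c \<noteq> p"
      using assms x by (auto simp: vec_eq_iff optimum_def)
    then have "0 < (c - p) \<bullet> ((\<Sum>i\<in>UNIV. gradient (f i) c) - (\<Sum>i\<in>UNIV. gradient (f i) p))"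
      using strict unfolding strictly_convex_def gradient_sum by auto
    \<comment> \<open>At a consensus vector the stacked inner product collapses to one with the
      gradient of the sum, where strict convexity applies.\<close>
    also have "\<dots> = (x - optimum) \<bullet> (grads x - grads optimum)"
      by (subst inner_vec_def)
         (simp add: grads_def optimum_def x sum_subtractf[symmetric] inner_sum_right)
    finally show False
      using zero by simp
  qed
  then show ?thesis
    using dissipation_nonneg[of x] by simp
qed

section \<open>Invariance and Lyapunov decrease along solutions\<close>

lemma sum_dual_invariant:
  assumes z: "solves \<theta> z" and init: "(\<Sum>i\<in>UNIV. snd (z 0) $ i) = 0" and t: "t \<ge> 0"
  shows "(\<Sum>i\<in>UNIV. snd (z t) $ i) = 0"
proof -
  have "((\<lambda>t. \<Sum>i\<in>UNIV. snd (z t) $ i) has_vector_derivative 0) (at s within {0..})"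
    if "s \<in> {0..}" for s
  proof -
    have "((\<lambda>t. \<Sum>i\<in>UNIV. snd (z t) $ i) has_vector_derivative
        (\<Sum>i\<in>UNIV. snd (\<theta> s *\<^sub>R saddle_field (z s)) $ i)) (at s within {0..})"
      using z that unfolding solves_def
      by (intro has_vector_derivative_sum bounded_linear.has_vector_derivative[OF bounded_linear_vec_nth]
          bounded_linear.has_vector_derivative[OF bounded_linear_snd]) auto
    \<comment> \<open>The dual velocity is a multiple of a Laplacian image, whose entries sum to
      zero.\<close>
    moreover have "(\<Sum>i\<in>UNIV. snd (\<theta> s *\<^sub>R saddle_field (z s)) $ i) = 0"
      using sum_laplacian[of A "fst (z s)", OF adjacency_symmetric] by (simp add: saddle_field_def scaleR_sum_right[symmetric])
    ultimately show ?thesis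
      by simp
  qed
  then have "\<exists>c. \<forall>s\<in>{0..}. (\<Sum>i\<in>UNIV. snd (z s) $ i) = c"
    by (intro has_derivative_zero_constant) (auto simp: has_vector_derivative_def)
  then obtain c where c: "\<And>s. s \<ge> 0 \<Longrightarrow> (\<Sum>i\<in>UNIV. snd (z s) $ i) = c"
    by auto
  from c[of t] c[of 0] init t show ?thesis
    by simp
qed

lemma lyapunov_function:
  "\<exists>V c. c > 0 \<and> (\<forall>z. c * (norm (z - equilibrium))\<^sup>2 \<le> V z) \<and>
    (\<forall>z \<theta> t. solves \<theta> z \<longrightarrow> (\<Sum>i\<in>UNIV. snd (z 0) $ i) = 0 \<longrightarrow> t \<ge> 0 \<longrightarrow>
      ((\<lambda>t. V (z t)) has_vector_derivative - (\<theta> t * dissipation (fst (z t)))) (at t within {0..}))"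
proof -
  obtain K :: "real ^ 'd ^ 'n \<Rightarrow> real ^ 'd ^ 'n"
    where K: "linear K" "\<And>x y. K x \<bullet> y = x \<bullet> K y" "\<And>y. y \<noteq> 0 \<Longrightarrow> K y \<bullet> y > 0"
      "\<And>x y. (\<Sum>i\<in>UNIV. y $ i) = 0 \<Longrightarrow> K (laplacian A x) \<bullet> y = x \<bullet> y"
    using laplacian_generalized_inverse[OF graph] by metis
  obtain k where k: "k > 0" "\<And>y. k * (norm y)\<^sup>2 \<le> K y \<bullet> y"
    using positive_definite_coercive[OF K(1,3)] by blast
  have ab: "\<alpha> * \<beta> > 0"
    using \<alpha> \<beta> by simp
  define X where "X z = fst z - optimum" for z :: "(real ^ 'd ^ 'n) \<times> (real ^ 'd ^ 'n)"
  define Y where "Y z = snd z + \<alpha> *\<^sub>R grads optimum" for z :: "(real ^ 'd ^ 'n) \<times> (real ^ 'd ^ 'n)"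
  \<comment> \<open>The weight \<open>1 / (2 * (\<alpha> * \<beta>))\<close> cancels the factor
    \<alpha> \<beta> of the dual equation, so that the two cross terms match.\<close>
  define V where "V z = (X z \<bullet> X z) / 2 + (K (Y z) \<bullet> Y z) / (2 * (\<alpha> * \<beta>))" for z
  define c where "c = min (1 / 2) (k / (2 * (\<alpha> * \<beta>)))"
  show ?thesis
  proof (intro exI[of _ V] exI[of _ c] conjI allI impI)
    show "c > 0"
      using k ab by (simp add: c_def)
    show "c * (norm (z - equilibrium))\<^sup>2 \<le> V z" for z
    proof -
      have "(norm (z - equilibrium))\<^sup>2 = (norm (X z))\<^sup>2 + (norm (Y z))\<^sup>2"
        by (simp add: norm_prod_def X_def Y_def equilibrium_def)
      then have "c * (norm (z - equilibrium))\<^sup>2 = c * (norm (X z))\<^sup>2 + c * (norm (Y z))\<^sup>2"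
        by (simp add: distrib_left)
      also have "c * (norm (X z))\<^sup>2 \<le> 1 / 2 * (norm (X z))\<^sup>2"
        by (intro mult_right_mono) (auto simp: c_def)
      also have "c * (norm (Y z))\<^sup>2 \<le> k / (2 * (\<alpha> * \<beta>)) * (norm (Y z))\<^sup>2"
        by (intro mult_right_mono) (auto simp: c_def)
      also have "\<dots> = k * (norm (Y z))\<^sup>2 / (2 * (\<alpha> * \<beta>))"
        by simp
      also have "\<dots> \<le> (K (Y z) \<bullet> Y z) / (2 * (\<alpha> * \<beta>))"
        using k(2) ab by (intro divide_right_mono) auto
      finally show ?thesis
        by (simp add: V_def power2_norm_eq_inner)
    qed
    fix z \<tau> and t :: real
    assume z: "solves \<tau> z" and init: "(\<Sum>i\<in>UNIV. snd (z 0) $ i) = 0" and t: "t \<ge> 0"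
    define T :: "real set" where "T = {0..}"
    define \<theta> where "\<theta> = \<tau> t"
    have der: "(z has_vector_derivative \<theta> *\<^sub>R saddle_field (z t)) (at t within T)"
      using z t by (simp add: solves_def T_def \<theta>_def)
    have sum_v: "(\<Sum>i\<in>UNIV. snd (z t) $ i) = 0"
      by (rule sum_dual_invariant[OF z init t])
    have sum_Y: "(\<Sum>i\<in>UNIV. Y (z t) $ i) = 0"
      using sum_v sum_gradient_minimum
      by (simp add: Y_def sum.distrib grads_def optimum_def scaleR_sum_right[symmetric])
    \<comment> \<open>The field in coordinates centred at \<open>equilibrium\<close>: the dual shift
      turns the gradients into gradient differences.\<close>
    define x' where "x' = - (\<alpha> *\<^sub>R (grads (fst (z t)) - grads optimum))
      - \<beta> *\<^sub>R laplacian A (X (z t)) - Y (z t)"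
    define y' where "y' = (\<alpha> * \<beta>) *\<^sub>R laplacian A (X (z t))"
    have "((\<lambda>t. X (z t)) has_vector_derivative \<theta> *\<^sub>R x') (at t within T)"
    proof -
      have "((\<lambda>t. X (z t)) has_vector_derivative fst (\<theta> *\<^sub>R saddle_field (z t)) - 0) (at t within T)"
        unfolding X_def
        by (intro has_vector_derivative_diff bounded_linear.has_vector_derivative[OF bounded_linear_fst]
            der has_vector_derivative_const)
      moreover have "fst (\<theta> *\<^sub>R saddle_field (z t)) - 0 = \<theta> *\<^sub>R x'"
        by (simp add: saddle_field_def x'_def X_def Y_def laplacian_diff_optimum algebra_simps)
      ultimately show ?thesis
        by (simp only:)
    qed
    note X' = bounded_bilinear.has_vector_derivative[OF bounded_bilinear_inner this this]
    have dY: "((\<lambda>t. Y (z t)) has_vector_derivative \<theta> *\<^sub>R y') (at t within T)"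
    proof -
      have "((\<lambda>t. Y (z t)) has_vector_derivative snd (\<theta> *\<^sub>R saddle_field (z t)) + 0) (at t within T)"
        unfolding Y_def
        by (intro has_vector_derivative_add bounded_linear.has_vector_derivative[OF bounded_linear_snd]
            der has_vector_derivative_const)
      then show ?thesis
        by (simp add: saddle_field_def y'_def X_def laplacian_diff_optimum)
    qed
    have "bounded_linear K"
      using K(1) by (simp add: linear_conv_bounded_linear)
    from bounded_linear.has_vector_derivative[OF this dY]
    have "((\<lambda>t. K (Y (z t))) has_vector_derivative K (\<theta> *\<^sub>R y')) (at t within T)" .
    note Y' = bounded_bilinear.has_vector_derivative[OF bounded_bilinear_inner this dY]
    have "((\<lambda>t. V (z t)) has_vector_derivative
        (X (z t) \<bullet> (\<theta> *\<^sub>R x') + (\<theta> *\<^sub>R x') \<bullet> X (z t)) / 2 +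
        (K (Y (z t)) \<bullet> (\<theta> *\<^sub>R y') + K (\<theta> *\<^sub>R y') \<bullet> Y (z t)) / (2 * (\<alpha> * \<beta>))) (at t within T)"
      unfolding V_def
      by (intro has_vector_derivative_add has_vector_derivative_divide X' Y')
    moreover have "(X (z t) \<bullet> (\<theta> *\<^sub>R x') + (\<theta> *\<^sub>R x') \<bullet> X (z t)) / 2 = \<theta> * (X (z t) \<bullet> x')"
      by (simp add: inner_commute)
    moreover have "(K (Y (z t)) \<bullet> (\<theta> *\<^sub>R y') + K (\<theta> *\<^sub>R y') \<bullet> Y (z t)) / (2 * (\<alpha> * \<beta>)) =
        \<theta> * (X (z t) \<bullet> Y (z t))"
    proof -
      have "K (Y (z t)) \<bullet> y' = K y' \<bullet> Y (z t)"
        by (simp add: K(2) inner_commute)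
      \<comment> \<open>Here the zero sum of \<open>Y\<close> enters: against such vectors
        \<open>K\<close> undoes the Laplacian.\<close>
      moreover have "K y' \<bullet> Y (z t) = (\<alpha> * \<beta>) * (X (z t) \<bullet> Y (z t))"
        using K(4)[OF sum_Y, of "X (z t)"] by (simp add: y'_def linear_scale[OF K(1)])
      ultimately show ?thesis
        using \<alpha> \<beta> by (simp add: linear_scale[OF K(1)])
    qed
    \<comment> \<open>The term \<open>- Y\<close> in \<open>x'\<close> cancels the dual
      contribution; what remains is the dissipation.\<close>
    moreover have "\<theta> * (X (z t) \<bullet> x') + \<theta> * (X (z t) \<bullet> Y (z t)) = - (\<theta> * dissipation (fst (z t)))"
      by (simp add: x'_def dissipation_def X_def[symmetric] inner_diff_right inner_commute algebra_simps)
    ultimately show "((\<lambda>t. V (z t)) has_vector_derivative - (\<tau> t * dissipation (fst (z t)))) (at t within {0..})"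
      by (simp only: T_def \<theta>_def)
  qed
qed

text \<open>Since the Lyapunov function never increases, its initial value bounds the distance.
  \<open>B\<close> is uniform in \<theta> and \<open>z\<close>, so a cut-off can be built from it
  before any solution is known.\<close>

lemma a_priori_bound:
  assumes init: "(\<Sum>i\<in>UNIV. snd z0 $ i) = 0"
  shows "\<exists>B. \<forall>z \<theta> t. solves \<theta> z \<longrightarrow> z 0 = z0 \<longrightarrow> (\<forall>t. \<theta> t \<ge> 0) \<longrightarrow> t \<ge> 0 \<longrightarrow>
    norm (z t - equilibrium) \<le> B"
proof -
  obtain V c where c: "c > 0" and V: "\<forall>z. c * (norm (z - equilibrium))\<^sup>2 \<le> V z"
    "\<forall>z \<theta> t. solves \<theta> z \<longrightarrow> (\<Sum>i\<in>UNIV. snd (z 0) $ i) = 0 \<longrightarrow> t \<ge> 0 \<longrightarrow>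
      ((\<lambda>t. V (z t)) has_vector_derivative - (\<theta> t * dissipation (fst (z t)))) (at t within {0..})"
    using lyapunov_function by blast
  have "norm (z t - equilibrium) \<le> sqrt (V z0 / c)"
    if z: "solves \<theta> z" "z 0 = z0" and \<theta>: "\<forall>t. \<theta> t \<ge> 0" and t: "t \<ge> 0" for z \<theta> t
  proof -
    have "((\<lambda>s. - (\<theta> s * dissipation (fst (z s)))) has_integral V (z t) - V (z 0)) {0..t}"
    proof (rule fundamental_theorem_of_calculus[OF t])
      fix s assume s: "s \<in> {0..t}"
      then have "((\<lambda>s. V (z s)) has_vector_derivative - (\<theta> s * dissipation (fst (z s)))) (at s within {0..})"
        using V(2) z init by simp
      then show "((\<lambda>s. V (z s)) has_vector_derivative - (\<theta> s * dissipation (fst (z s)))) (at s within {0..t})"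
        by (rule has_vector_derivative_within_subset) auto
    qed
    from has_integral_le[OF this has_integral_0] have "V (z t) \<le> V z0"
      using \<theta> dissipation_nonneg z by auto
    moreover have "c * (norm (z t - equilibrium))\<^sup>2 \<le> V (z t)"
      using V(1) by blast
    ultimately have "(norm (z t - equilibrium))\<^sup>2 \<le> V z0 / c"
      using c by (simp add: field_simps)
    then show ?thesis
      by (rule real_le_rsqrt)
  qed
  then show ?thesis
    by blast
qed

section \<open>Global existence and convergence\<close>

lemma global_solution:
  assumes init: "(\<Sum>i\<in>UNIV. snd z0 $ i) = 0"
  shows "\<exists>z. z 0 = z0 \<and> solves (\<lambda>_. 1) z"
proof -
  obtain B where B: "\<forall>z \<theta> t. solves \<theta> z \<longrightarrow> z 0 = z0 \<longrightarrow> (\<forall>t. \<theta> t \<ge> 0) \<longrightarrow> t \<ge> 0 \<longrightarrow>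
      norm (z t - equilibrium) \<le> B"
    using a_priori_bound[OF init] by blast
  \<comment> \<open>Equal to 1 within distance \<open>B\<close> of the equilibrium and to 0 beyond
    \<open>B + 1\<close>.\<close>
  define cutoff where "cutoff z = max 0 (min 1 (B + 1 - norm (z - equilibrium)))" for z
  have cont: "continuous_on UNIV (\<lambda>z. cutoff z *\<^sub>R saddle_field z)"
    unfolding cutoff_def by (intro continuous_intros continuous_on_saddle_field)
  have "compact (saddle_field ` cball equilibrium (B + 1))"
    by (intro compact_continuous_image continuous_on_subset[OF continuous_on_saddle_field]) auto
  then obtain M where M: "\<And>z. z \<in> cball equilibrium (B + 1) \<Longrightarrow> norm (saddle_field z) \<le> M"
    by (metis bounded_iff compact_imp_bounded image_eqI)
  have bound: "norm (cutoff z *\<^sub>R saddle_field z) \<le> max 0 M" for z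
  proof (cases "z \<in> cball equilibrium (B + 1)")
    case True
    have "norm (cutoff z *\<^sub>R saddle_field z) \<le> 1 * M"
      unfolding norm_scaleR using M[OF True] by (intro mult_mono) (auto simp: cutoff_def)
    then show ?thesis
      by simp
  next
    case False
    then have "cutoff z = 0"
      by (simp add: cutoff_def dist_norm norm_minus_commute)
    then show ?thesis
      by simp
  qed
  obtain z where z0: "z 0 = z0"
    and "\<And>t. t \<ge> 0 \<Longrightarrow> (z has_vector_derivative cutoff (z t) *\<^sub>R saddle_field (z t)) (at t within {0..})"
    using peano_existence_bounded[OF cont bound] by metis
  \<comment> \<open>The cut-off evaluated along the solution serves as the time factor, so the bound
    \<open>B\<close> applies to this very solution.\<close>
  then have z: "solves (\<lambda>t. cutoff (z t)) z"
    by (simp add: solves_def)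
  have "norm (z t - equilibrium) \<le> B" if "t \<ge> 0" for t
  proof -
    have "\<forall>t. cutoff (z t) \<ge> 0"
      by (simp add: cutoff_def)
    with B z z0 that show ?thesis
      by blast
  qed
  then have cutoff_1: "cutoff (z t) = 1" if "t \<ge> 0" for t
    unfolding cutoff_def using that by (smt (verit))
  then have "solves (\<lambda>_. 1) z"
    using z cutoff_1 by (simp add: solves_def)
  with z0 show ?thesis
    by blast
qed

lemma solution_tendsto_optimum:
  assumes z: "solves (\<lambda>_. 1) z" and init: "(\<Sum>i\<in>UNIV. snd (z 0) $ i) = 0"
  shows "((\<lambda>t. fst (z t)) \<longlongrightarrow> optimum) at_top"
proof -
  obtain B where "\<forall>z' \<theta> t. solves \<theta> z' \<longrightarrow> z' 0 = z 0 \<longrightarrow> (\<forall>t. \<theta> t \<ge> 0) \<longrightarrow> t \<ge> 0 \<longrightarrow>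
      norm (z' t - equilibrium) \<le> B"
    using a_priori_bound[OF init] by blast
  then have B: "norm (z t - equilibrium) \<le> B" if "t \<ge> 0" for t
    using that z by (metis zero_le_one)
  obtain V c where c: "c > 0" and V: "\<forall>z. c * (norm (z - equilibrium))\<^sup>2 \<le> V z"
    "\<forall>z \<theta> t. solves \<theta> z \<longrightarrow> (\<Sum>i\<in>UNIV. snd (z 0) $ i) = 0 \<longrightarrow> t \<ge> 0 \<longrightarrow>
      ((\<lambda>t. V (z t)) has_vector_derivative - (\<theta> t * dissipation (fst (z t)))) (at t within {0..})"
    using lyapunov_function by blast
  have V_nonneg: "V w \<ge> 0" for w
    using spec[OF V(1), of w] c order_trans[of 0 "c * (norm (w - equilibrium))\<^sup>2" "V w"] by simp
  have z_ball: "z t \<in> cball equilibrium B" if "t \<ge> 0" for t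
    using B[OF that] by (simp add: dist_norm norm_minus_commute)
  have "compact (saddle_field ` cball equilibrium B)"
    by (intro compact_continuous_image continuous_on_subset[OF continuous_on_saddle_field]) auto
  then obtain M where M: "\<And>w. w \<in> cball equilibrium B \<Longrightarrow> norm (saddle_field w) \<le> M"
    by (metis bounded_iff compact_imp_bounded image_eqI)
  have M_nonneg: "0 \<le> M"
    using norm_ge_zero M[OF z_ball[of 0]] by (rule order_trans) simp
  \<comment> \<open>Mean value inequality on the half-line, with the field bounded by
    \<open>M\<close> on the ball that contains the solution.\<close>
  have z_lip: "norm (z s - z t) \<le> M * norm (s - t)" if "s \<ge> 0" "t \<ge> 0" for s t
  proof (rule differentiable_bound)
    show "(z has_derivative (\<lambda>h. h *\<^sub>R saddle_field (z u))) (at u within {0..})" if "u \<in> {0..}" for u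
      using z that by (simp add: solves_def has_vector_derivative_def)
    show "onorm (\<lambda>h. h *\<^sub>R saddle_field (z u)) \<le> M" if "u \<in> {0..}" for u
      using M[OF z_ball[of u]] that by (intro onorm_le) (simp add: mult.commute[of M] mult_left_mono)
  qed (use that in auto)
  have "M-lipschitz_on {0..} (\<lambda>t. fst (z t))"
  proof (rule lipschitz_onI)
    fix s t :: real assume "s \<in> {0..}" "t \<in> {0..}"
    then show "dist (fst (z s)) (fst (z t)) \<le> M * dist s t"
      using z_lip[of s t] dist_fst_le[of "z s" "z t"] by (simp add: dist_norm)
  qed (rule M_nonneg)
  moreover have "bounded ((\<lambda>t. fst (z t)) ` {0..})"
  proof -
    have "bounded (z ` {0..})"
      using z_ball by (intro bounded_subset[OF bounded_cball]) auto
    from bounded_fst[OF this] show ?thesis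
      by (simp add: image_image)
  qed
  moreover have "((\<lambda>t. V (z t)) has_vector_derivative - dissipation (fst (z t))) (at t within {0..})"
    if "t \<ge> 0" for t
  proof -
    have "((\<lambda>t. V (z t)) has_vector_derivative - (1 * dissipation (fst (z t)))) (at t within {0..})"
      using V(2) z init that by blast
    then show ?thesis
      by simp
  qed
  ultimately show ?thesis
    using V_nonneg continuous_on_dissipation dissipation_nonneg dissipation_pos
    by (intro lyapunov_tendsto[where V = "\<lambda>t. V (z t)" and W = dissipation and M = M and x = "\<lambda>t. fst (z t)"])
qed

end

section \<open>From stacked solutions to families indexed by nodes\<close>

theorem theorem8:
  fixes A :: "real ^ 'n ^ 'n"
    and f :: "'n \<Rightarrow> real ^ 'd \<Rightarrow> real"
    and xstar :: "real ^ 'd"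
    and \<alpha> \<beta> :: real
    and x0 v0 :: "'n \<Rightarrow> real ^ 'd"
  assumes "connected_weighted_graph A"
    and "\<And>i. convex_on UNIV (f i)"
    and "\<And>i y. f i differentiable at y"
    and "strictly_convex (\<lambda>y. \<Sum>i\<in>UNIV. f i y)"
    and "\<And>y. (\<Sum>i\<in>UNIV. f i xstar) \<le> (\<Sum>i\<in>UNIV. f i y)"
    and "\<alpha> > 0" and "\<beta> > 0"
    and "(\<Sum>i\<in>UNIV. v0 i) = 0"
  shows "(\<exists>x v. is_trajectory A f \<alpha> \<beta> x v \<and> (\<forall>i. x i 0 = x0 i \<and> v i 0 = v0 i)) \<and>
    (\<forall>x v. is_trajectory A f \<alpha> \<beta> x v \<and> (\<forall>i. x i 0 = x0 i \<and> v i 0 = v0 i) \<longrightarrow>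
      (\<forall>i. (x i \<longlongrightarrow> xstar) at_top))"
proof -
  interpret consensus_optimization A f xstar \<alpha> \<beta>
    by unfold_locales (fact assms)+
  show ?thesis
  proof (intro conjI allI impI)
    \<comment> \<open>Existence: the components of the global solution for the stacked initial data
      form a trajectory.\<close>
    obtain z where z: "z 0 = ((\<chi> i. x0 i), (\<chi> i. v0 i))"
      "\<And>t. t \<ge> 0 \<Longrightarrow> (z has_vector_derivative saddle_field (z t)) (at t within {0..})"
      using global_solution[of "((\<chi> i. x0 i), (\<chi> i. v0 i))"] assms(8) by (auto simp: solves_def)
    have "((\<lambda>t. fst (z t) $ i) has_vector_derivative fst (saddle_field (z t)) $ i) (at t within {0..})"
      "((\<lambda>t. snd (z t) $ i) has_vector_derivative snd (saddle_field (z t)) $ i) (at t within {0..})"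
      if "t \<ge> 0" for i t
      using z(2)[OF that]
      by (intro bounded_linear.has_vector_derivative[OF bounded_linear_vec_nth]
          bounded_linear.has_vector_derivative[OF bounded_linear_fst]
          bounded_linear.has_vector_derivative[OF bounded_linear_snd]; assumption)+
    then have "is_trajectory A f \<alpha> \<beta> (\<lambda>i t. fst (z t) $ i) (\<lambda>i t. snd (z t) $ i)"
      unfolding is_trajectory_def by (simp add: saddle_field_def grads_def laplacian_def)
    then show "\<exists>x v. is_trajectory A f \<alpha> \<beta> x v \<and> (\<forall>i. x i 0 = x0 i \<and> v i 0 = v0 i)"
      using z(1) by (intro exI conjI) auto
  next
    fix x v i
    assume "is_trajectory A f \<alpha> \<beta> x v \<and> (\<forall>i. x i 0 = x0 i \<and> v i 0 = v0 i)"
    then have traj: "is_trajectory A f \<alpha> \<beta> x v" and init: "\<And>i. v i 0 = v0 i"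
      by auto
    \<comment> \<open>Convergence: any given trajectory is stacked into a solution with zero-sum
      initial dual part.\<close>
    define z where "z t = ((\<chi> i. x i t), (\<chi> i. v i t))" for t
    have "(z has_vector_derivative saddle_field (z t)) (at t within {0..})" if "t \<ge> 0" for t
    proof -
      have "saddle_field (z t) =
          ((\<chi> i. - (\<alpha> *\<^sub>R gradient (f i) (x i t))
              - \<beta> *\<^sub>R (\<Sum>j\<in>UNIV. (A $ i $ j) *\<^sub>R (x i t - x j t)) - v i t),
           (\<chi> i. (\<alpha> * \<beta>) *\<^sub>R (\<Sum>j\<in>UNIV. (A $ i $ j) *\<^sub>R (x i t - x j t))))"
        by (simp add: saddle_field_def z_def grads_def laplacian_def vec_eq_iff)
      then show ?thesis
        using traj that unfolding z_def is_trajectory_def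
        by (simp add: has_vector_derivative_Pair has_vector_derivative_vec_lambda)
    qed
    then have "solves (\<lambda>_. 1) z"
      by (simp add: solves_def)
    then have "((\<lambda>t. fst (z t)) \<longlongrightarrow> optimum) at_top"
      by (rule solution_tendsto_optimum) (simp add: z_def init assms(8))
    from tendsto_vec_nth[OF this, of i] show "(x i \<longlongrightarrow> xstar) at_top"
      by (simp add: z_def optimum_def)
  qed
qed

end
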